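(* Let $\Theta=(\theta_1,\dots,\theta_n)$ be a $\mathbf{\Theta}_n$-inner function. Then, for every $\alpha\in\mathbb T$, $$(\alpha^m+\theta_1,\ \alpha^m\theta_1+\theta_2,\ \dots,\ \alpha^m\theta_{n-2}+\theta_{n-1},\ \alpha^m\theta_{n-1}+\theta_n^p,\ \alpha^{m/p}\theta_n)$$ is a $\mathbf{\Theta}_{n+1}$-inner function.
   Context: $\mathbb D$ is the open unit disc, $\mathbb T$ the unit circle. Fix positive integers $m,p$ with $p$ dividing $m$, and $n\ge2$. For each $d\ge2$ let $s_i$ be the $i$-th elementary symmetric polynomial in $d$ variables, define $\theta^{(d)}:\mathbb C^d\to\mathbb C^d$ by $\theta^{(d)}(z)=\big(s_1(z_1^m,\dots,z_d^m),\dots,s_{d-1}(z_1^m,\dots,z_d^m),(z_1\cdots z_d)^{m/p}\big)$, and set $\mathbf{\Theta}_d=\theta^{(d)}(\mathbb D^d)$, $\overline{\mathbf{\Theta}}_d=\theta^{(d)}(\overline{\mathbb D}^d)$ (same $m,p$ for all $d$). The distinguished boundary $b\mathbf{\Theta}_d$ is the Shilov boundary of $\overline{\mathbf{\Theta}}_d$, i.e. the smallest closed subset of $\overline{\mathbf{\Theta}}_d$ on which every function continuous on $\overline{\mathbf{\Theta}}_d$ and holomorphic in $\mathbf{\Theta}_d$ attains its maximum modulus (it is known to equal $\theta^{(d)}(\mathbb T^d)$). A $\mathbf{\Theta}_d$-inner function is a holomorphic map $\mathbb D\to\overline{\mathbf{\Theta}}_d$ whose radial limits belong to $b\mathbf{\Theta}_d$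 at Lebesgue-a.e. point of $\mathbb T$. Here $\theta_n^p(z)=(\theta_n(z))^p$. *)

theory Defs
  imports "HOL-Analysis.Analysis"
begin

text \<open>
  The dimension varies inside the statement, so a vector of $d$ complex numbers is a function
  on the indices \<open>1, ..., d\<close> extended by \<open>0\<close>. The product topology of \<open>nat \<Rightarrow> complex\<close>
  restricts to the Euclidean topology on \<open>cspace d\<close>, which is a closed subset.
\<close>

definition cspace :: "nat \<Rightarrow> (nat \<Rightarrow> complex) set" where
  "cspace d = {z. \<forall>i. i \<notin> {1..d} \<longrightarrow> z i = 0}"

definition polydisc :: "nat \<Rightarrow> (nat \<Rightarrow> complex) set" where
  "polydisc d = {z \<in> cspace d. \<forall>i\<in>{1..d}. cmod (z i) < 1}"

definition closed_polydisc :: "nat \<Rightarrow> (nat \<Rightarrow> complex) set" where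
  "closed_polydisc d = {z \<in> cspace d. \<forall>i\<in>{1..d}. cmod (z i) \<le> 1}"

definition esym :: "nat \<Rightarrow> nat \<Rightarrow> (nat \<Rightarrow> complex) \<Rightarrow> complex" where
  "esym d i x = (\<Sum>S | S \<subseteq> {1..d} \<and> card S = i. \<Prod>j\<in>S. x j)"

definition theta :: "nat \<Rightarrow> nat \<Rightarrow> nat \<Rightarrow> (nat \<Rightarrow> complex) \<Rightarrow> nat \<Rightarrow> complex" where
  "theta m p d z =
     (\<lambda>i. if 1 \<le> i \<and> i < d then esym d i (\<lambda>j. z j ^ m)
          else if i = d then (\<Prod>j=1..d. z j) ^ (m div p)
          else 0)"

definition Theta_dom :: "nat \<Rightarrow> nat \<Rightarrow> nat \<Rightarrow> (nat \<Rightarrow> complex) set" where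
  "Theta_dom m p d = theta m p d ` polydisc d"

definition closed_Theta_dom :: "nat \<Rightarrow> nat \<Rightarrow> nat \<Rightarrow> (nat \<Rightarrow> complex) set" where
  "closed_Theta_dom m p d = theta m p d ` closed_polydisc d"

text \<open>
  Holomorphy on a (relatively) open subset \<open>U\<close> of \<open>cspace d\<close>: complex Frechet
  differentiability at every point, with the complex gradient \<open>a\<close>.
\<close>

definition holomorphic_Cn :: "nat \<Rightarrow> ((nat \<Rightarrow> complex) \<Rightarrow> complex) \<Rightarrow> (nat \<Rightarrow> complex) set \<Rightarrow> bool" where
  "holomorphic_Cn d f U \<longleftrightarrow>
     (\<forall>z\<in>U. \<exists>a :: nat \<Rightarrow> complex.
        ((\<lambda>w. (f w - f z - (\<Sum>i=1..d. a i * (w i - z i)))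
               / of_real (L2_set (\<lambda>i. cmod (w i - z i)) {1..d})) \<longlongrightarrow> 0) (at z within U))"

definition Theta_algebra :: "nat \<Rightarrow> nat \<Rightarrow> nat \<Rightarrow> ((nat \<Rightarrow> complex) \<Rightarrow> complex) set" where
  "Theta_algebra m p d =
     {f. continuous_on (closed_Theta_dom m p d) f \<and> holomorphic_Cn d f (Theta_dom m p d)}"

definition closed_boundary :: "nat \<Rightarrow> nat \<Rightarrow> nat \<Rightarrow> (nat \<Rightarrow> complex) set \<Rightarrow> bool" where
  "closed_boundary m p d K \<longleftrightarrow>
     closed K \<and> K \<subseteq> closed_Theta_dom m p d \<and>
     (\<forall>f\<in>Theta_algebra m p d. \<exists>x\<in>K. \<forall>y\<in>closed_Theta_dom m p d. cmod (f y) \<le> cmod (f x))"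

text \<open>\<open>LEAST\<close> refers to the inclusion order on sets.\<close>

definition distinguished_boundary :: "nat \<Rightarrow> nat \<Rightarrow> nat \<Rightarrow> (nat \<Rightarrow> complex) set" where
  "distinguished_boundary m p d = (LEAST K. closed_boundary m p d K)"

text \<open>
  Lebesgue measure on the unit circle is taken in the angle \<open>t\<close>. A bounded holomorphic map
  has radial limits almost everywhere (Fatou); the existence of the limit is part of the
  almost-everywhere condition below.
\<close>

definition Theta_inner :: "nat \<Rightarrow> nat \<Rightarrow> nat \<Rightarrow> (complex \<Rightarrow> nat \<Rightarrow> complex) \<Rightarrow> bool" where
  "Theta_inner m p d \<psi> \<longleftrightarrow>
     (\<forall>i\<in>{1..d}. (\<lambda>z. \<psi> z i) holomorphic_on ball 0 1) \<and>
     \<psi> ` ball 0 1 \<subseteq> closed_Theta_dom m p d \<and>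
     (AE t in lebesgue_on {0..2*pi}.
        \<exists>L\<in>distinguished_boundary m p d.
          ((\<lambda>r. \<psi> (of_real r * cis t)) \<longlongrightarrow> L) (at_left (1::real)))"

end

theory Submission
  imports Defs "HOL-Complex_Analysis.Conformal_Mappings"
    "HOL-Computational_Algebra.Fundamental_Theorem_Algebra"
begin

text \<open>
  The stated formula sends \<open>theta m p n z\<close> to \<open>theta m p (n + 1) (z, \<alpha>)\<close>: it is the recursion for
  elementary symmetric polynomials when one variable is added (\<open>adjoin_theta\<close>). Since \<open>\<alpha>\<close> is unimodular,
  it maps the image of the closed polydisc into the image of the closed polydisc of one dimension
  more, and likewise for the tori. As the formula is polynomial, it preserves holomorphy and radial
  limits. The theorem follows once the distinguished boundary is known to be the image of the torus
  in both dimensions (\<open>distinguished_boundary_eq\<close>), and this is the main part of the work.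

  The image of the torus is a closed boundary by the maximum principle: a function in the algebra,
  pulled back to the polydisc, is continuous on the closure and holomorphic in each variable
  (\<open>polydisc_maximum_principle\<close>, \<open>closed_boundary_theta_torus\<close>).

  It is contained in every closed boundary \<open>K\<close> (\<open>theta_torus_subset_closed_boundary\<close>). Given \<open>w\<close> in the
  torus whose image is not in \<open>K\<close>, one needs a function in the algebra that is larger at the image
  of \<open>w\<close> than anywhere on \<open>K\<close>. On the polydisc, products of functions \<open>(1 + u) / 2\<close> peak at the points
  whose \<open>m\<close>-th powers are those of \<open>w\<close> in a prescribed order. Summing high powers of them over all
  orders gives a symmetric function, namely a permanent. By Ryser's formula (\<open>ryser_formula\<close>) it is a
  combination of products \<open>\<Prod>j. Q (z j ^ m)\<close> with polynomials \<open>Q\<close>, and these are polynomials in the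
  coordinates of \<open>theta m p d z\<close> (\<open>descends_prod_poly\<close>). So the symmetric function comes from the algebra.
\<close>

section \<open>Coordinatewise topology and the torus\<close>

lemma tendsto_coordinatewise_iff:
  fixes f :: "'a \<Rightarrow> 'b \<Rightarrow> 'c::topological_space"
  shows "(f \<longlongrightarrow> l) F \<longleftrightarrow> (\<forall>i. ((\<lambda>x. f x i) \<longlongrightarrow> l i) F)"
  using limitin_componentwise[of "\<lambda>_. euclidean" UNIV f l F]
  by (simp add: euclidean_product_topology)

lemma continuous_on_coordinate:
  "continuous_on S (\<lambda>x::'b \<Rightarrow> 'c::topological_space. x i)"
  by (rule continuous_on_subset[OF continuous_on_product_coordinates]) simp

lemma compact_product:
  fixes S :: "'a \<Rightarrow> 'b::topological_space set"
  assumes "\<And>i. compact (S i)"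
  shows "compact {z. \<forall>i. z i \<in> S i}"
proof -
  have "compactin (product_topology (\<lambda>_. euclidean) UNIV) (PiE UNIV S)"
    unfolding compactin_PiE using assms by simp
  moreover have "PiE UNIV S = {z. \<forall>i. z i \<in> S i}"
    by (auto simp: PiE_iff)
  ultimately show ?thesis
    by (simp add: euclidean_product_topology)
qed

definition torus :: "nat \<Rightarrow> (nat \<Rightarrow> complex) set" where
  "torus d = {z \<in> cspace d. \<forall>i\<in>{1..d}. cmod (z i) = 1}"

lemma torus_subset: "torus d \<subseteq> closed_polydisc d"
  by (auto simp: torus_def closed_polydisc_def)

lemma polydisc_subset: "polydisc d \<subseteq> closed_polydisc d"
  by (auto simp: polydisc_def closed_polydisc_def less_imp_le)

lemma compact_torus: "compact (torus d)"
proof -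
  have "torus d = {z. \<forall>i. z i \<in> (if i \<in> {1..d} then sphere 0 1 else {0})}"
    by (auto simp: torus_def cspace_def)
  thus ?thesis
    by (simp add: compact_product)
qed

lemma compact_closed_polydisc: "compact (closed_polydisc d)"
proof -
  have "closed_polydisc d = {z. \<forall>i. z i \<in> (if i \<in> {1..d} then cball 0 1 else {0})}"
    by (auto simp: closed_polydisc_def cspace_def)
  thus ?thesis
    by (simp add: compact_product)
qed

lemma torus_nonempty: "torus d \<noteq> {}"
proof -
  have "(\<lambda>i. if i \<in> {1..d} then 1 else 0) \<in> torus d"
    by (auto simp: torus_def cspace_def)
  thus ?thesis by blast
qed

section \<open>The maximum principle on the polydisc\<close>

text \<open>
  A slice through a point with some coordinates on the boundary need not be covered by the
  holomorphy hypothesis, so coordinates cannot be pushed to the torus one at a time in the closed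
  polydisc itself. They can be for the dilated functions \<open>z \<mapsto> G (r z)\<close> with \<open>r < 1\<close>, whose slices
  are holomorphic beyond the closed unit disc. Compactness of the torus then allows \<open>r \<rightarrow> 1\<close>.
\<close>

lemma polydisc_maximum_principle:
  assumes cont: "continuous_on (closed_polydisc d) G"
    and hol: "\<And>z j. z \<in> polydisc d \<Longrightarrow> j \<in> {1..d} \<Longrightarrow>
                (\<lambda>\<zeta>. G (z(j := \<zeta>))) holomorphic_on ball 0 1"
    and M: "\<And>w. w \<in> torus d \<Longrightarrow> cmod (G w) \<le> M"
    and z: "z \<in> closed_polydisc d"
  shows "cmod (G z) \<le> M"
proof -
  define dil where "dil = (\<lambda>(r::real) (z::nat \<Rightarrow> complex) i. of_real r * z i)"
  have dil_in: "dil r z \<in> polydisc d" if "z \<in> closed_polydisc d" "0 \<le> r" "r < 1" for r z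
  proof -
    have "r * cmod (z i) < 1" if "cmod (z i) \<le> 1" for i
      using mult_left_mono[OF that \<open>0 \<le> r\<close>] \<open>r < 1\<close> by simp
    thus ?thesis
      using that by (auto simp: polydisc_def closed_polydisc_def cspace_def dil_def norm_mult)
  qed
  have step: "cmod (G (dil r z)) \<le> B"
    if r: "0 \<le> r" "r < 1" and B: "\<And>w. w \<in> torus d \<Longrightarrow> cmod (G (dil r w)) \<le> B"
      and z: "z \<in> closed_polydisc d" for r B z
  proof -
    \<comment> \<open>Only the first \<open>k\<close> coordinates are still free; each induction step moves one of them to the circle.\<close>
    have "cmod (G (dil r z)) \<le> B"
      if "z \<in> closed_polydisc d" "\<forall>i\<in>{k+1..d}. cmod (z i) = 1" for k z
      using that
    proof (induction k arbitrary: z)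
      case 0
      then show ?case
        by (intro B) (auto simp: torus_def closed_polydisc_def)
    next
      case (Suc k)
      show ?case
      proof (cases "Suc k \<le> d")
        case False
        then show ?thesis using Suc by simp
      next
        case True
        define h where "h = (\<lambda>\<zeta>. G (dil r (z(Suc k := \<zeta>))))"
        have eq: "dil r (z(Suc k := \<zeta>)) = (dil r z)(Suc k := of_real r * \<zeta>)" for \<zeta>
          by (auto simp: dil_def)
        have "(\<lambda>\<zeta>. G ((dil r z)(Suc k := \<zeta>))) holomorphic_on ball 0 1"
          by (rule hol) (use True dil_in[OF Suc.prems(1) r] in auto)
        moreover have "(\<lambda>\<zeta>. of_real r * \<zeta>) ` cball (0::complex) 1 \<subseteq> ball 0 1"
        proof -
          have "r * cmod \<zeta> < 1" if "cmod \<zeta> \<le> 1" for \<zeta>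
            using mult_left_mono[OF that \<open>0 \<le> r\<close>] \<open>r < 1\<close> by simp
          thus ?thesis using r by (auto simp: norm_mult)
        qed
        ultimately have "((\<lambda>\<zeta>. G ((dil r z)(Suc k := \<zeta>))) \<circ> (\<lambda>\<zeta>. of_real r * \<zeta>))
            holomorphic_on cball 0 1"
          by (intro holomorphic_on_compose_gen[of _ _ _ "ball 0 1"])
             (auto intro!: holomorphic_intros)
        hence h: "h holomorphic_on cball 0 1"
          by (simp add: h_def eq o_def)
        have "cmod (h (z (Suc k))) \<le> B"
        proof (rule maximum_modulus_frontier[of h "cball 0 1"])
          show "h holomorphic_on interior (cball 0 1)"
            using h by (rule holomorphic_on_subset) auto
          show "continuous_on (closure (cball 0 1)) h"
            using holomorphic_on_imp_continuous_on[OF h] by simp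
          show "z (Suc k) \<in> cball 0 1"
            using Suc.prems True by (auto simp: closed_polydisc_def)
          fix \<zeta> :: complex assume "\<zeta> \<in> frontier (cball 0 1)"
          hence "cmod \<zeta> = 1" by simp
          thus "cmod (h \<zeta>) \<le> B"
            unfolding h_def using Suc.prems True
            by (intro Suc.IH) (auto simp: closed_polydisc_def cspace_def)
        qed auto
        thus ?thesis by (simp add: h_def)
      qed
    qed
    from this[of z d] z show ?thesis by simp
  qed
  have cont_dil: "continuous_on (torus d) (\<lambda>w. cmod (G (dil r w)))" if "0 \<le> r" "r < 1" for r
  proof (intro continuous_on_norm continuous_on_compose2[OF cont])
    show "continuous_on (torus d) (dil r)"
      unfolding dil_def
      by (intro continuous_on_coordinatewise_then_product continuous_on_mult
            continuous_on_const continuous_on_coordinate)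
    show "dil r ` torus d \<subseteq> closed_polydisc d"
      using dil_in[OF _ that] torus_subset polydisc_subset by blast
  qed
  have "\<exists>w\<in>torus d. \<forall>z\<in>closed_polydisc d. cmod (G (dil r z)) \<le> cmod (G (dil r w))"
    if "0 \<le> r" "r < 1" for r
    using continuous_attains_sup[OF compact_torus torus_nonempty cont_dil[OF that]] step[OF that]
    by meson
  hence "\<forall>r. \<exists>w. 0 \<le> r \<and> r < 1 \<longrightarrow> w \<in> torus d \<and>
            (\<forall>z\<in>closed_polydisc d. cmod (G (dil r z)) \<le> cmod (G (dil r w)))"
    by blast
  then obtain w where w: "\<And>r. 0 \<le> r \<Longrightarrow> r < 1 \<Longrightarrow> w r \<in> torus d"
    "\<And>r z. 0 \<le> r \<Longrightarrow> r < 1 \<Longrightarrow> z \<in> closed_polydisc d \<Longrightarrow> cmod (G (dil r z)) \<le> cmod (G (dil r (w r)))"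
    by metis
  \<comment> \<open>The dilation factors tend to \<open>1\<close>; the maximum points on the torus accumulate at some \<open>l\<close>.\<close>
  define \<rho> where "\<rho> = (\<lambda>n. real n / real (Suc n))"
  have \<rho>: "0 \<le> \<rho> n" "\<rho> n < 1" for n
    by (auto simp: \<rho>_def)
  have \<rho>_lim: "\<rho> \<longlonglongrightarrow> 1"
    unfolding \<rho>_def by (rule LIMSEQ_n_over_Suc_n)
  obtain l s where l: "l \<in> torus d" and s: "strict_mono s"
    and lim: "((\<lambda>n. w (\<rho> n)) \<circ> s) \<longlonglongrightarrow> l"
    using compact_torus[unfolded compact_def, of d] w(1)[OF \<rho>] by metis
  have \<rho>s: "(\<lambda>n. \<rho> (s n)) \<longlonglongrightarrow> 1"
    using LIMSEQ_subseq_LIMSEQ[OF \<rho>_lim s] by (simp add: o_def)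
  have "(\<lambda>n. dil (\<rho> (s n)) (w (\<rho> (s n)))) \<longlonglongrightarrow> l"
    unfolding tendsto_coordinatewise_iff dil_def
  proof
    fix i
    have "(\<lambda>n. w (\<rho> (s n)) i) \<longlonglongrightarrow> l i"
      using lim by (simp add: tendsto_coordinatewise_iff o_def)
    from tendsto_mult[OF tendsto_of_real[OF \<rho>s] this]
    show "(\<lambda>n. of_real (\<rho> (s n)) * w (\<rho> (s n)) i) \<longlonglongrightarrow> l i" by simp
  qed
  hence lim1: "(\<lambda>n. cmod (G (dil (\<rho> (s n)) (w (\<rho> (s n)))))) \<longlonglongrightarrow> cmod (G l)"
    using l torus_subset dil_in[OF _ \<rho>] w(1)[OF \<rho>] polydisc_subset
    by (intro tendsto_norm continuous_on_tendsto_compose[OF cont] always_eventually) blast+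
  have "(\<lambda>n. dil (\<rho> (s n)) z) \<longlonglongrightarrow> z"
    unfolding tendsto_coordinatewise_iff dil_def
  proof
    fix i
    from tendsto_mult[OF tendsto_of_real[OF \<rho>s] tendsto_const[of "z i"]]
    show "(\<lambda>n. of_real (\<rho> (s n)) * z i) \<longlonglongrightarrow> z i" by simp
  qed
  hence lim2: "(\<lambda>n. cmod (G (dil (\<rho> (s n)) z))) \<longlonglongrightarrow> cmod (G z)"
    using z torus_subset dil_in[OF _ \<rho>] polydisc_subset
    by (intro tendsto_norm continuous_on_tendsto_compose[OF cont] always_eventually) blast+
  have "cmod (G z) \<le> cmod (G l)"
    by (rule LIMSEQ_le[OF lim2 lim1]) (use w(2)[OF \<rho> z] in auto)
  with M[OF l] show ?thesis by simp
qed

section \<open>The image of the torus is a closed boundary\<close>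

lemma theta_in_cspace: "d \<ge> 1 \<Longrightarrow> theta m p d z \<in> cspace d"
  by (auto simp: theta_def cspace_def)

lemma continuous_on_esym:
  assumes "\<And>j. continuous_on S (\<lambda>z. f z j)"
  shows "continuous_on S (\<lambda>z. esym d i (f z))"
  unfolding esym_def by (intro continuous_intros assms)

lemma continuous_on_theta: "continuous_on S (theta m p d)"
proof (rule continuous_on_coordinatewise_then_product)
  fix i
  show "continuous_on S (\<lambda>z. theta m p d z i)"
    unfolding theta_def
    by (cases "1 \<le> i \<and> i < d"; cases "i = d")
       (auto intro!: continuous_intros continuous_on_esym continuous_on_coordinate)
qed

lemma theta_slice_holomorphic: "(\<lambda>\<zeta>. theta m p d (z(j := \<zeta>)) i) holomorphic_on V"
proof -
  have *: "(\<lambda>\<zeta>. (z(j := \<zeta>)) k) holomorphic_on V" for k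
    by (cases "k = j") (auto intro!: holomorphic_intros)
  show ?thesis
    unfolding theta_def esym_def
    by (cases "1 \<le> i \<and> i < d"; cases "i = d") (auto intro!: holomorphic_intros * simp del: fun_upd_apply)
qed

lemma compact_theta_torus: "compact (theta m p d ` torus d)"
  by (intro compact_continuous_image continuous_on_theta compact_torus)

text \<open>
  The chain rule works with the gradient relative to \<open>U\<close> because \<open>h\<close> only visits points of \<open>U\<close>. It
  makes pullbacks along the basic map holomorphic in each variable, even at the branch points of
  that map.
\<close>

lemma holomorphic_Cn_compose:
  assumes f: "holomorphic_Cn d f U" and U: "U \<subseteq> cspace d" "\<And>\<zeta>. \<zeta> \<in> V \<Longrightarrow> h \<zeta> \<in> U"
    and h: "\<And>i. (\<lambda>\<zeta>. h \<zeta> i) holomorphic_on V"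
  shows "(\<lambda>\<zeta>. f (h \<zeta>)) holomorphic_on V"
  unfolding holomorphic_on_def field_differentiable_def
proof
  fix \<zeta>0 assume \<zeta>0: "\<zeta>0 \<in> V"
  define N where "N = (\<lambda>w. L2_set (\<lambda>i. cmod (w i - h \<zeta>0 i)) {1..d})"
  from f U \<zeta>0 obtain a where
    lim: "((\<lambda>w. (f w - f (h \<zeta>0) - (\<Sum>i=1..d. a i * (w i - h \<zeta>0 i))) / of_real (N w)) \<longlongrightarrow> 0)
           (at (h \<zeta>0) within U)"
    unfolding holomorphic_Cn_def N_def by blast
  define E where "E = (\<lambda>w. (f w - f (h \<zeta>0) - (\<Sum>i=1..d. a i * (w i - h \<zeta>0 i))) / of_real (N w))"
  \<comment> \<open>Division by zero gives \<open>E\<close> the value \<open>0\<close> at the base point, so \<open>E\<close> is continuous there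
     and may be composed with \<open>h\<close> even if \<open>h\<close> returns to that point.\<close>
  have E0: "E (h \<zeta>0) = 0" by (simp add: E_def)
  from h \<zeta>0 have "\<forall>i. \<exists>D. ((\<lambda>\<zeta>. h \<zeta> i) has_field_derivative D) (at \<zeta>0 within V)"
    unfolding holomorphic_on_def field_differentiable_def by blast
  then obtain D where D: "\<And>i. ((\<lambda>\<zeta>. h \<zeta> i) has_field_derivative D i) (at \<zeta>0 within V)"
    by metis
  have quot: "((\<lambda>\<zeta>. (h \<zeta> i - h \<zeta>0 i) / (\<zeta> - \<zeta>0)) \<longlongrightarrow> D i) (at \<zeta>0 within V)" for i
    using D[of i] by (simp add: has_field_derivative_iff)
  have "(h \<longlongrightarrow> h \<zeta>0) (at \<zeta>0 within V)"
    unfolding tendsto_coordinatewise_iff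
    using DERIV_continuous[OF D] by (auto simp: continuous_within)
  moreover have "continuous (at (h \<zeta>0) within U) E"
    using lim unfolding continuous_within E0 unfolding E_def .
  ultimately have E_lim: "((\<lambda>\<zeta>. E (h \<zeta>)) \<longlongrightarrow> 0) (at \<zeta>0 within V)"
    using continuous_within_tendsto_compose[of "h \<zeta>0" U E h "at \<zeta>0 within V"] U(2)
    by (auto simp: E0 eventually_at_filter)
  have expand: "f (h \<zeta>) - f (h \<zeta>0) =
      E (h \<zeta>) * of_real (N (h \<zeta>)) + (\<Sum>i=1..d. a i * (h \<zeta> i - h \<zeta>0 i))" if "\<zeta> \<in> V" for \<zeta>
  proof (cases "N (h \<zeta>) = 0")
    case True
    hence "\<forall>i\<in>{1..d}. h \<zeta> i = h \<zeta>0 i"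
      by (simp add: N_def L2_set_eq_0_iff)
    moreover have "h \<zeta> i = h \<zeta>0 i" if "i \<notin> {1..d}" for i
    proof -
      have "h \<zeta> \<in> cspace d" "h \<zeta>0 \<in> cspace d"
        using U(1) U(2)[OF \<zeta>0] U(2)[OF \<open>\<zeta> \<in> V\<close>] by blast+
      thus ?thesis using that unfolding cspace_def by simp
    qed
    ultimately have "h \<zeta> = h \<zeta>0" by blast
    thus ?thesis using True by simp
  qed (simp add: E_def)
  have N_le: "N (h \<zeta>) \<le> (\<Sum>i=1..d. cmod (h \<zeta> i - h \<zeta>0 i))" for \<zeta>
    unfolding N_def by (rule L2_set_le_sum) auto
  have "((\<lambda>\<zeta>. E (h \<zeta>) * (of_real (N (h \<zeta>)) / (\<zeta> - \<zeta>0))) \<longlongrightarrow> 0) (at \<zeta>0 within V)"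
  proof (rule Lim_null_comparison)
    show "\<forall>\<^sub>F \<zeta> in at \<zeta>0 within V. cmod (E (h \<zeta>) * (of_real (N (h \<zeta>)) / (\<zeta> - \<zeta>0))) \<le>
        cmod (E (h \<zeta>)) * (\<Sum>i=1..d. cmod ((h \<zeta> i - h \<zeta>0 i) / (\<zeta> - \<zeta>0)))"
    proof (rule always_eventually, rule allI)
      fix \<zeta>
      have "N (h \<zeta>) \<ge> 0" by (simp add: N_def)
      hence "cmod (of_real (N (h \<zeta>)) / (\<zeta> - \<zeta>0)) \<le> (\<Sum>i=1..d. cmod (h \<zeta> i - h \<zeta>0 i)) / cmod (\<zeta> - \<zeta>0)"
        using N_le[of \<zeta>] by (simp add: norm_divide divide_right_mono)
      thus "cmod (E (h \<zeta>) * (of_real (N (h \<zeta>)) / (\<zeta> - \<zeta>0))) \<le>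
        cmod (E (h \<zeta>)) * (\<Sum>i=1..d. cmod ((h \<zeta> i - h \<zeta>0 i) / (\<zeta> - \<zeta>0)))"
        unfolding norm_mult by (intro mult_left_mono) (auto simp: norm_divide sum_divide_distrib)
    qed
    have "((\<lambda>\<zeta>. cmod (E (h \<zeta>)) * (\<Sum>i=1..d. cmod ((h \<zeta> i - h \<zeta>0 i) / (\<zeta> - \<zeta>0)))) \<longlongrightarrow>
          cmod 0 * (\<Sum>i=1..d. cmod (D i))) (at \<zeta>0 within V)"
      by (intro tendsto_intros E_lim quot)
    thus "((\<lambda>\<zeta>. cmod (E (h \<zeta>)) * (\<Sum>i=1..d. cmod ((h \<zeta> i - h \<zeta>0 i) / (\<zeta> - \<zeta>0)))) \<longlongrightarrow> 0)
          (at \<zeta>0 within V)" by simp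
  qed
  moreover have "((\<lambda>\<zeta>. \<Sum>i=1..d. a i * ((h \<zeta> i - h \<zeta>0 i) / (\<zeta> - \<zeta>0))) \<longlongrightarrow> (\<Sum>i=1..d. a i * D i))
      (at \<zeta>0 within V)"
    by (intro tendsto_intros quot)
  ultimately have "((\<lambda>\<zeta>. E (h \<zeta>) * (of_real (N (h \<zeta>)) / (\<zeta> - \<zeta>0)) +
        (\<Sum>i=1..d. a i * ((h \<zeta> i - h \<zeta>0 i) / (\<zeta> - \<zeta>0)))) \<longlongrightarrow> 0 + (\<Sum>i=1..d. a i * D i))
      (at \<zeta>0 within V)"
    by (rule tendsto_add)
  moreover have "\<forall>\<^sub>F \<zeta> in at \<zeta>0 within V. E (h \<zeta>) * (of_real (N (h \<zeta>)) / (\<zeta> - \<zeta>0)) +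
        (\<Sum>i=1..d. a i * ((h \<zeta> i - h \<zeta>0 i) / (\<zeta> - \<zeta>0))) = (f (h \<zeta>) - f (h \<zeta>0)) / (\<zeta> - \<zeta>0)"
    by (auto simp: eventually_at_filter expand add_divide_distrib sum_divide_distrib)
  ultimately have "((\<lambda>\<zeta>. (f (h \<zeta>) - f (h \<zeta>0)) / (\<zeta> - \<zeta>0)) \<longlongrightarrow> (\<Sum>i=1..d. a i * D i)) (at \<zeta>0 within V)"
    using filterlim_cong[OF refl refl] by (force elim: Lim_transform_eventually)
  thus "\<exists>f'. ((\<lambda>\<zeta>. f (h \<zeta>)) has_field_derivative f') (at \<zeta>0 within V)"
    unfolding has_field_derivative_iff by blast
qed

lemma closed_boundary_theta_torus:
  assumes d: "d \<ge> 1"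
  shows "closed_boundary m p d (theta m p d ` torus d)"
  unfolding closed_boundary_def
proof (intro conjI ballI)
  show "closed (theta m p d ` torus d)"
    by (rule compact_imp_closed[OF compact_theta_torus])
  show "theta m p d ` torus d \<subseteq> closed_Theta_dom m p d"
    unfolding closed_Theta_dom_def using torus_subset by blast
  fix f assume f: "f \<in> Theta_algebra m p d"
  define G where "G = (\<lambda>z. f (theta m p d z))"
  have cont: "continuous_on (closed_polydisc d) G"
    unfolding G_def using f
    by (intro continuous_on_compose2[OF _ continuous_on_theta])
       (auto simp: Theta_algebra_def closed_Theta_dom_def)
  have hol: "(\<lambda>\<zeta>. G (z(j := \<zeta>))) holomorphic_on ball 0 1"
    if "z \<in> polydisc d" "j \<in> {1..d}" for z j
    unfolding G_def
  proof (rule holomorphic_Cn_compose[where f = f and U = "Theta_dom m p d" and d = d])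
    show "holomorphic_Cn d f (Theta_dom m p d)"
      using f by (simp add: Theta_algebra_def)
    show "Theta_dom m p d \<subseteq> cspace d"
      using theta_in_cspace[OF d] by (auto simp: Theta_dom_def)
    show "theta m p d (z(j := \<zeta>)) \<in> Theta_dom m p d" if "\<zeta> \<in> ball 0 1" for \<zeta>
      unfolding Theta_dom_def using \<open>z \<in> polydisc d\<close> \<open>j \<in> {1..d}\<close> that
      by (intro imageI) (auto simp: polydisc_def cspace_def)
  qed (rule theta_slice_holomorphic)
  have "continuous_on (torus d) (\<lambda>w. cmod (G w))"
    using cont torus_subset by (intro continuous_on_norm) (rule continuous_on_subset)
  from continuous_attains_sup[OF compact_torus torus_nonempty this]
  obtain w where w: "w \<in> torus d" "\<And>z. z \<in> torus d \<Longrightarrow> cmod (G z) \<le> cmod (G w)" by blast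
  have "cmod (G z) \<le> cmod (G w)" if "z \<in> closed_polydisc d" for z
    using polydisc_maximum_principle[OF cont hol w(2) that] .
  thus "\<exists>x\<in>theta m p d ` torus d. \<forall>y\<in>closed_Theta_dom m p d. cmod (f y) \<le> cmod (f x)"
    using w(1) by (auto simp: G_def closed_Theta_dom_def)
qed

section \<open>Functions that descend along the basic map\<close>

lemma Theta_dom_subset: "Theta_dom m p d \<subseteq> closed_Theta_dom m p d"
  unfolding Theta_dom_def closed_Theta_dom_def by (intro image_mono polydisc_subset)

lemma Theta_algebra_const: "(\<lambda>_. c) \<in> Theta_algebra m p d"
  unfolding Theta_algebra_def holomorphic_Cn_def
  by (auto intro!: exI[of _ "\<lambda>_. 0"])

lemma Theta_algebra_coordinate:
  assumes "i \<in> {1..d}"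
  shows "(\<lambda>w. w i) \<in> Theta_algebra m p d"
proof -
  have "(\<Sum>j=1..d. (if j = i then 1 else 0) * (w j - z j)) = w i - z i" for w z :: "nat \<Rightarrow> complex"
    using assms by (simp add: sum.delta if_distrib[of "\<lambda>x. x * _"] cong: if_cong)
  thus ?thesis
    unfolding Theta_algebra_def holomorphic_Cn_def
    by (auto intro!: exI[of _ "\<lambda>j. if j = i then 1 else 0"] continuous_on_coordinate)
qed

lemma Theta_algebra_add:
  assumes f: "f \<in> Theta_algebra m p d" and g: "g \<in> Theta_algebra m p d"
  shows "(\<lambda>w. f w + g w) \<in> Theta_algebra m p d"
  unfolding Theta_algebra_def mem_Collect_eq holomorphic_Cn_def
proof (intro conjI ballI)
  show "continuous_on (closed_Theta_dom m p d) (\<lambda>w. f w + g w)"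
    using assms by (auto simp: Theta_algebra_def intro!: continuous_intros)
  fix z assume z: "z \<in> Theta_dom m p d"
  define N where "N = (\<lambda>w. complex_of_real (L2_set (\<lambda>i. cmod (w i - z i)) {1..d}))"
  define L where "L = (\<lambda>a (w::nat \<Rightarrow> complex). \<Sum>i=1..d. a i * (w i - z i))"
  from f g z obtain a b where
    a: "((\<lambda>w. (f w - f z - L a w) / N w) \<longlongrightarrow> 0) (at z within Theta_dom m p d)" and
    b: "((\<lambda>w. (g w - g z - L b w) / N w) \<longlongrightarrow> 0) (at z within Theta_dom m p d)"
    unfolding Theta_algebra_def holomorphic_Cn_def N_def L_def by blast
  have "L (\<lambda>i. a i + b i) w = L a w + L b w" for w
    by (simp add: L_def algebra_simps flip: sum.distrib)
  hence "(f w + g w - (f z + g z) - L (\<lambda>i. a i + b i) w) / N w =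
      (f w - f z - L a w) / N w + (g w - g z - L b w) / N w" for w
    by (simp add: add_divide_distrib diff_divide_distrib)
  hence "((\<lambda>w. (f w + g w - (f z + g z) - L (\<lambda>i. a i + b i) w) / N w) \<longlongrightarrow> 0)
      (at z within Theta_dom m p d)"
    using tendsto_add[OF a b] by simp
  thus "\<exists>a. ((\<lambda>w. (f w + g w - (f z + g z) - (\<Sum>i=1..d. a i * (w i - z i))) /
      complex_of_real (L2_set (\<lambda>i. cmod (w i - z i)) {1..d})) \<longlongrightarrow> 0) (at z within Theta_dom m p d)"
    unfolding N_def L_def by (rule exI[where x = "\<lambda>i. a i + b i"])
qed

text \<open>
  Besides the two first-order remainders, the product rule leaves the cross term
  \<open>(f w - f z) * L b w\<close>. It is negligible because \<open>L b\<close> is bounded by a multiple of the distance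
  and \<open>f\<close> is continuous.
\<close>

lemma Theta_algebra_mult:
  assumes f: "f \<in> Theta_algebra m p d" and g: "g \<in> Theta_algebra m p d"
  shows "(\<lambda>w. f w * g w) \<in> Theta_algebra m p d"
  unfolding Theta_algebra_def mem_Collect_eq holomorphic_Cn_def
proof (intro conjI ballI)
  show "continuous_on (closed_Theta_dom m p d) (\<lambda>w. f w * g w)"
    using assms by (auto simp: Theta_algebra_def intro!: continuous_intros)
  fix z assume z: "z \<in> Theta_dom m p d"
  define N where "N = (\<lambda>w. complex_of_real (L2_set (\<lambda>i. cmod (w i - z i)) {1..d}))"
  define L where "L = (\<lambda>a (w::nat \<Rightarrow> complex). \<Sum>i=1..d. a i * (w i - z i))"
  from f g z obtain a b where
    a: "((\<lambda>w. (f w - f z - L a w) / N w) \<longlongrightarrow> 0) (at z within Theta_dom m p d)" and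
    b: "((\<lambda>w. (g w - g z - L b w) / N w) \<longlongrightarrow> 0) (at z within Theta_dom m p d)"
    unfolding Theta_algebra_def holomorphic_Cn_def N_def L_def by blast
  have "continuous_on (closed_Theta_dom m p d) f"
    using f by (simp add: Theta_algebra_def)
  hence "continuous_on (Theta_dom m p d) f"
    using Theta_dom_subset by (rule continuous_on_subset)
  hence f_lim: "(f \<longlongrightarrow> f z) (at z within Theta_dom m p d)"
    using z by (simp add: continuous_on_def)
  have L_bound: "cmod (L b w / N w) \<le> (\<Sum>i=1..d. cmod (b i))" for w
  proof -
    have "cmod (b i * (w i - z i) / N w) \<le> cmod (b i)" if "i \<in> {1..d}" for i
    proof -
      have "cmod (w i - z i) \<le> cmod (N w)"
        using member_le_L2_set[OF _ that, of "\<lambda>i. cmod (w i - z i)"] by (simp add: N_def)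
      hence "cmod (w i - z i) / cmod (N w) \<le> 1"
        by (simp add: divide_le_eq_1)
      from mult_left_mono[OF this norm_ge_zero[of "b i"]] show ?thesis
        by (simp add: norm_mult norm_divide)
    qed
    hence "(\<Sum>i=1..d. cmod (b i * (w i - z i) / N w)) \<le> (\<Sum>i=1..d. cmod (b i))"
      by (rule sum_mono)
    thus ?thesis
      unfolding L_def sum_divide_distrib by (rule order_trans[OF norm_sum])
  qed
  have cross: "((\<lambda>w. (f w - f z) * (L b w / N w)) \<longlongrightarrow> 0) (at z within Theta_dom m p d)"
  proof (rule Lim_null_comparison)
    show "\<forall>\<^sub>F w in at z within Theta_dom m p d.
        cmod ((f w - f z) * (L b w / N w)) \<le> cmod (f w - f z) * (\<Sum>i=1..d. cmod (b i))"
      unfolding norm_mult using L_bound by (intro always_eventually allI mult_left_mono) auto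
    have "((\<lambda>w. cmod (f w - f z) * (\<Sum>i=1..d. cmod (b i))) \<longlongrightarrow>
        cmod (f z - f z) * (\<Sum>i=1..d. cmod (b i))) (at z within Theta_dom m p d)"
      by (intro tendsto_intros f_lim)
    thus "((\<lambda>w. cmod (f w - f z) * (\<Sum>i=1..d. cmod (b i))) \<longlongrightarrow> 0) (at z within Theta_dom m p d)"
      by simp
  qed
  have "L (\<lambda>i. f z * b i + g z * a i) w = f z * L b w + g z * L a w" for w
    by (simp add: L_def sum_distrib_left algebra_simps flip: sum.distrib)
  hence "(f w * g w - f z * g z - L (\<lambda>i. f z * b i + g z * a i) w) / N w =
      f w * ((g w - g z - L b w) / N w) + g z * ((f w - f z - L a w) / N w)
      + (f w - f z) * (L b w / N w)" for w
    by (simp add: divide_inverse algebra_simps)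
  moreover have "((\<lambda>w. f w * ((g w - g z - L b w) / N w) + g z * ((f w - f z - L a w) / N w)
      + (f w - f z) * (L b w / N w)) \<longlongrightarrow> f z * 0 + g z * 0 + 0) (at z within Theta_dom m p d)"
    by (intro tendsto_add tendsto_mult tendsto_const f_lim a b cross)
  ultimately have "((\<lambda>w. (f w * g w - f z * g z - L (\<lambda>i. f z * b i + g z * a i) w) / N w) \<longlongrightarrow> 0)
      (at z within Theta_dom m p d)"
    by simp
  thus "\<exists>a. ((\<lambda>w. (f w * g w - f z * g z - (\<Sum>i=1..d. a i * (w i - z i))) /
      complex_of_real (L2_set (\<lambda>i. cmod (w i - z i)) {1..d})) \<longlongrightarrow> 0) (at z within Theta_dom m p d)"
    unfolding N_def L_def by (rule exI[where x = "\<lambda>i. f z * b i + g z * a i"])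
qed

text \<open>
  The functions on the closed polydisc that factor through the basic map with a factor in the
  algebra. They will be produced from the coordinate functions by ring operations only; a set-theoretic
  descent of an invariant function would leave holomorphy at the branch points to be shown.
\<close>

definition descends :: "nat \<Rightarrow> nat \<Rightarrow> nat \<Rightarrow> ((nat \<Rightarrow> complex) \<Rightarrow> complex) \<Rightarrow> bool" where
  "descends m p d F \<longleftrightarrow>
     (\<exists>f\<in>Theta_algebra m p d. \<forall>z\<in>closed_polydisc d. f (theta m p d z) = F z)"

lemma descends_const: "descends m p d (\<lambda>_. c)"
  unfolding descends_def by (rule bexI[where x = "\<lambda>_. c"]) (auto intro: Theta_algebra_const)

lemma descends_theta: "i \<in> {1..d} \<Longrightarrow> descends m p d (\<lambda>z. theta m p d z i)"
  unfolding descends_def by (rule bexI[where x = "\<lambda>w. w i"]) (auto intro: Theta_algebra_coordinate)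

lemma descends_add:
  assumes "descends m p d F" and "descends m p d G"
  shows "descends m p d (\<lambda>z. F z + G z)"
proof -
  from assms obtain f g where f: "f \<in> Theta_algebra m p d" and g: "g \<in> Theta_algebra m p d"
    and "\<forall>z\<in>closed_polydisc d. f (theta m p d z) = F z"
    and "\<forall>z\<in>closed_polydisc d. g (theta m p d z) = G z"
    unfolding descends_def by blast
  thus ?thesis
    unfolding descends_def by (intro bexI[OF _ Theta_algebra_add[OF f g]]) simp
qed

lemma descends_mult:
  assumes "descends m p d F" and "descends m p d G"
  shows "descends m p d (\<lambda>z. F z * G z)"
proof -
  from assms obtain f g where f: "f \<in> Theta_algebra m p d" and g: "g \<in> Theta_algebra m p d"
    and "\<forall>z\<in>closed_polydisc d. f (theta m p d z) = F z"
    and "\<forall>z\<in>closed_polydisc d. g (theta m p d z) = G z"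
    unfolding descends_def by blast
  thus ?thesis
    unfolding descends_def by (intro bexI[OF _ Theta_algebra_mult[OF f g]]) simp
qed

lemma descends_power: "descends m p d F \<Longrightarrow> descends m p d (\<lambda>z. F z ^ k)"
  by (induction k) (auto intro: descends_const descends_mult)

lemma descends_sum:
  "(\<And>i. i \<in> I \<Longrightarrow> descends m p d (F i)) \<Longrightarrow> descends m p d (\<lambda>z. \<Sum>i\<in>I. F i z)"
  by (induction I rule: infinite_finite_induct) (auto intro: descends_const descends_add)

lemma descends_prod:
  "(\<And>i. i \<in> I \<Longrightarrow> descends m p d (F i)) \<Longrightarrow> descends m p d (\<lambda>z. \<Prod>i\<in>I. F i z)"
  by (induction I rule: infinite_finite_induct) (auto intro: descends_const descends_mult)

lemma esym_0: "esym d 0 x = 1"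
proof -
  have "{S. S \<subseteq> {1..d} \<and> card S = 0} = {{}}"
    by (auto dest: finite_subset)
  thus ?thesis by (simp add: esym_def)
qed

lemma esym_top: "esym d d x = (\<Prod>j=1..d. x j)"
proof -
  have "{S. S \<subseteq> {1..d} \<and> card S = d} = {{1..d}}"
    using card_subset_eq[of "{1..d}"] by auto
  thus ?thesis by (simp add: esym_def)
qed

lemma esym_top_eq_theta:
  assumes "p dvd m"
  shows "esym d d (\<lambda>j. z j ^ m) = theta m p d z d ^ p"
proof -
  have "theta m p d z d ^ p = (\<Prod>j=1..d. z j) ^ (m div p * p)"
    by (simp add: theta_def power_mult)
  also have "m div p * p = m"
    using assms by simp
  finally show ?thesis
    by (simp add: esym_top prod_power_distrib)
qed

lemma descends_esym:
  assumes "p dvd m" "d \<ge> 1" "i \<le> d"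
  shows "descends m p d (\<lambda>z. esym d i (\<lambda>j. z j ^ m))"
proof -
  consider "i = 0" | "1 \<le> i" "i < d" | "i = d" using assms by linarith
  thus ?thesis
  proof cases
    case 2
    hence "(\<lambda>z. esym d i (\<lambda>j. z j ^ m)) = (\<lambda>z. theta m p d z i)"
      by (simp add: theta_def)
    thus ?thesis using 2 by (simp add: descends_theta)
  next
    case 3
    thus ?thesis using assms by (simp add: esym_top_eq_theta descends_power descends_theta)
  qed (simp add: esym_0 descends_const)
qed

text \<open>
  Vieta's formula.
\<close>

lemma prod_add_const_eq_esym:
  "(\<Prod>j=1..d. x j + r) = (\<Sum>i\<le>d. esym d i x * r ^ (d - i))"
proof -
  have "(\<Prod>j=1..d. x j + r) = (\<Sum>S\<in>Pow {1..d}. (\<Prod>j\<in>S. x j) * r ^ (d - card S))"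
    by (subst prod_add) (auto intro!: sum.cong simp: card_Diff_subset finite_subset)
  also have "\<dots> = (\<Sum>i\<le>d. \<Sum>S\<in>{S\<in>Pow {1..d}. card S = i}. (\<Prod>j\<in>S. x j) * r ^ (d - card S))"
    by (subst sum.group) (use card_mono[of "{1..d}"] in auto)
  also have "\<dots> = (\<Sum>i\<le>d. esym d i x * r ^ (d - i))"
    unfolding esym_def sum_distrib_right by (intro sum.cong) auto
  finally show ?thesis .
qed

text \<open>
  Over the complex numbers \<open>Q\<close> splits into linear factors, and for a linear factor Vieta's formula
  writes the product over the variables in terms of elementary symmetric polynomials.
\<close>

lemma descends_prod_poly:
  assumes "p dvd m" "d \<ge> 1"
  shows "descends m p d (\<lambda>z. \<Prod>j=1..d. poly Q (z j ^ m))"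
proof -
  have lin: "descends m p d (\<lambda>z. \<Prod>j=1..d. z j ^ m - r)" for r
  proof -
    have "(\<Prod>j=1..d. z j ^ m - r) = (\<Sum>i\<le>d. esym d i (\<lambda>j. z j ^ m) * (- r) ^ (d - i))" for z
      using prod_add_const_eq_esym[of "\<lambda>j. z j ^ m" "- r" d] by simp
    moreover have "descends m p d (\<lambda>z. \<Sum>i\<le>d. esym d i (\<lambda>j. z j ^ m) * (- r) ^ (d - i))"
    proof (rule descends_sum)
      fix i assume "i \<in> {..d}"
      hence "descends m p d (\<lambda>z. esym d i (\<lambda>j. z j ^ m))"
        using assms by (intro descends_esym) auto
      thus "descends m p d (\<lambda>z. esym d i (\<lambda>j. z j ^ m) * (- r) ^ (d - i))"
        by (rule descends_mult) (rule descends_const)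
    qed
    ultimately show ?thesis by (simp only:)
  qed
  define R where "R = {r. poly Q r = 0}"
  have poly_eq: "poly Q x = lead_coeff Q * (\<Prod>r\<in>R. (x - r) ^ order r Q)" for x
    using arg_cong[OF complex_poly_decompose[of Q], of "\<lambda>q. poly q x"] by (simp add: poly_prod R_def)
  have "(\<Prod>j=1..d. poly Q (z j ^ m)) =
      lead_coeff Q ^ d * (\<Prod>r\<in>R. (\<Prod>j=1..d. z j ^ m - r) ^ order r Q)" for z
  proof -
    have "(\<Prod>j=1..d. poly Q (z j ^ m)) =
        lead_coeff Q ^ d * (\<Prod>j=1..d. \<Prod>r\<in>R. (z j ^ m - r) ^ order r Q)"
      unfolding poly_eq prod.distrib by simp
    also have "(\<Prod>j=1..d. \<Prod>r\<in>R. (z j ^ m - r) ^ order r Q) =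
        (\<Prod>r\<in>R. \<Prod>j=1..d. (z j ^ m - r) ^ order r Q)"
      by (rule prod.swap)
    finally show ?thesis by (simp only: prod_power_distrib)
  qed
  moreover have "descends m p d (\<lambda>z. lead_coeff Q ^ d *
      (\<Prod>r\<in>R. (\<Prod>j=1..d. z j ^ m - r) ^ order r Q))"
    by (rule descends_mult[OF descends_const descends_prod[OF descends_power[OF lin]]])
  ultimately show ?thesis by (simp only:)
qed

section \<open>Permanents\<close>

text \<open>
  Inclusion-exclusion, read off by expanding \<open>\<Prod>x\<in>D. 1 - [x \<notin> A]\<close>.
\<close>

lemma alternating_sum_supersets:
  assumes "finite D"
  shows "(\<Sum>S\<in>Pow D. (-1) ^ card (D - S) * (if A \<inter> D \<subseteq> S then 1 else 0)) =
         (if D \<subseteq> A then 1 else 0 :: 'a::comm_ring_1)"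
proof -
  have "(\<Prod>x\<in>D. 1 + (if x \<in> A then 0 else -1)) =
      (\<Sum>S\<in>Pow D. (\<Prod>x\<in>S. 1) * (\<Prod>x\<in>D-S. if x \<in> A then 0 else -1 :: 'a))"
    using assms by (rule prod_add)
  moreover have "(\<Prod>x\<in>D-S. if x \<in> A then 0 else -1 :: 'a) =
      (-1) ^ card (D - S) * (if A \<inter> D \<subseteq> S then 1 else 0)" for S
  proof (cases "A \<inter> D \<subseteq> S")
    case True
    hence "(\<Prod>x\<in>D-S. if x \<in> A then 0 else -1 :: 'a) = (\<Prod>x\<in>D-S. -1)"
      by (intro prod.cong) auto
    thus ?thesis using True by simp
  next
    case False
    thus ?thesis using assms by (auto intro!: prod_zero)
  qed
  moreover have "(\<Prod>x\<in>D. 1 + (if x \<in> A then 0 else -1)) = (if D \<subseteq> A then 1 else 0 :: 'a)"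
    using assms by (auto intro!: prod_zero prod.neutral)
  ultimately show ?thesis by simp
qed

text \<open>
  Functions in the extensional function space, so that the sum over them is a finite sum that
  arises directly from expanding a product of sums.
\<close>

definition perms :: "'a set \<Rightarrow> ('a \<Rightarrow> 'a) set" where
  "perms D = {g \<in> D \<rightarrow>\<^sub>E D. D \<subseteq> g ` D}"

text \<open>
  Expanding the products gives all maps \<open>g\<close> from \<open>D\<close> to \<open>S\<close>; the alternating sum over \<open>S\<close> keeps
  exactly the surjective ones. If \<open>a j k\<close> is the value of a polynomial \<open>q k\<close> at \<open>z j ^ m\<close>, then the
  product for a fixed \<open>S\<close> is that of the single polynomial \<open>\<Sum>k\<in>S. q k\<close> over all variables, so it
  descends.
\<close>

lemma ryser_formula:
  fixes a :: "'a \<Rightarrow> 'a \<Rightarrow> 'b::comm_ring_1"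
  assumes D: "finite D"
  shows "(\<Sum>g\<in>perms D. \<Prod>j\<in>D. a j (g j)) =
         (\<Sum>S\<in>Pow D. (-1) ^ card (D - S) * (\<Prod>j\<in>D. \<Sum>k\<in>S. a j k))"
proof -
  define P where "P = (\<lambda>g. \<Prod>j\<in>D. a j (g j))"
  have fin: "finite (D \<rightarrow>\<^sub>E D)" using D by (simp add: finite_PiE)
  have "(\<Prod>j\<in>D. \<Sum>k\<in>S. a j k) = (\<Sum>g\<in>D \<rightarrow>\<^sub>E D. P g * (if g ` D \<inter> D \<subseteq> S then 1 else 0))"
    if "S \<in> Pow D" for S
  proof -
    have "(\<Prod>j\<in>D. \<Sum>k\<in>S. a j k) = (\<Sum>g\<in>D \<rightarrow>\<^sub>E S. P g)"
      unfolding P_def using D that by (intro prod_sum_PiE) (auto intro: finite_subset)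
    also have "D \<rightarrow>\<^sub>E S = {g\<in>D \<rightarrow>\<^sub>E D. g ` D \<inter> D \<subseteq> S}"
      using that by (auto simp: PiE_iff extensional_def)
    finally show ?thesis
      using fin by (simp add: sum.inter_filter if_distrib[of "\<lambda>x. _ * x"] cong: if_cong)
  qed
  hence "(\<Sum>S\<in>Pow D. (-1) ^ card (D - S) * (\<Prod>j\<in>D. \<Sum>k\<in>S. a j k)) =
      (\<Sum>S\<in>Pow D. \<Sum>g\<in>D \<rightarrow>\<^sub>E D.
         P g * ((-1) ^ card (D - S) * (if g ` D \<inter> D \<subseteq> S then 1 else 0)))"
    by (intro sum.cong) (simp_all add: sum_distrib_left mult_ac)
  also have "\<dots> = (\<Sum>g\<in>D \<rightarrow>\<^sub>E D. P g * (if D \<subseteq> g ` D then 1 else 0))"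
    by (subst sum.swap) (simp only: sum_distrib_left[symmetric] alternating_sum_supersets[OF D])
  also have "\<dots> = (\<Sum>g\<in>perms D. P g)"
    unfolding perms_def using fin
    by (simp add: sum.inter_filter if_distrib[of "\<lambda>x. _ * x"] cong: if_cong)
  finally show ?thesis by (simp add: P_def)
qed

lemma esym_perm:
  assumes g: "g \<in> perms {1..d}" and x: "\<And>j. j \<in> {1..d} \<Longrightarrow> x j = y (g j)"
  shows "esym d i x = esym d i y"
proof -
  let ?F = "{S. S \<subseteq> {1..d} \<and> card S = i}"
  have surj: "g ` {1..d} = {1..d}" using g by (auto simp: perms_def)
  hence inj: "inj_on g {1..d}" by (simp add: finite_surj_inj)
  have inj': "inj_on g S" if "S \<in> ?F" for S using inj that by (auto intro: inj_on_subset)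
  have "?F \<subseteq> Pow {1..d}" by auto
  hence inj_F: "inj_on (image g) ?F"
    using inj_on_image_Pow[OF inj] by (rule inj_on_subset[rotated])
  have "image g ` ?F \<subseteq> ?F"
    using surj inj' by (fastforce simp: card_image)
  hence "image g ` ?F = ?F"
    using inj_F by (intro endo_inj_surj) auto
  hence "esym d i y = (\<Sum>S\<in>?F. \<Prod>j\<in>g ` S. y j)"
    unfolding esym_def using sum.reindex[OF inj_F, of "\<lambda>S. \<Prod>j\<in>S. y j"] by simp
  also have "\<dots> = esym d i x"
    unfolding esym_def
  proof (intro sum.cong refl)
    fix S assume S: "S \<in> ?F"
    have "(\<Prod>j\<in>g ` S. y j) = (\<Prod>j\<in>S. y (g j))"
      using prod.reindex[OF inj'[OF S]] by simp
    also have "\<dots> = (\<Prod>j\<in>S. x j)"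
      using S x by (intro prod.cong) auto
    finally show "(\<Prod>j\<in>g ` S. y j) = (\<Prod>j\<in>S. x j)" .
  qed
  finally show ?thesis by simp
qed

section \<open>Minimality of the image of the torus\<close>

lemma half_one_plus:
  assumes "cmod u \<le> 1"
  shows "cmod ((1 + u) / 2) \<le> 1" and "cmod ((1 + u) / 2) = 1 \<Longrightarrow> u = 1"
proof -
  show "cmod ((1 + u) / 2) \<le> 1"
    using norm_triangle_ineq[of 1 u] assms by (simp add: norm_divide)
  assume "cmod ((1 + u) / 2) = 1"
  hence "(cmod (1 + u))\<^sup>2 = 4" by (simp add: norm_divide)
  hence "(1 + Re u)\<^sup>2 + (Im u)\<^sup>2 = 4"
    unfolding cmod_power2 by simp
  hence 1: "1 + 2 * Re u + ((Re u)\<^sup>2 + (Im u)\<^sup>2) = 4"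
    by (simp add: power2_sum)
  have 2: "(Re u)\<^sup>2 + (Im u)\<^sup>2 \<le> 1"
    using power_mono[OF assms, of 2] by (simp add: cmod_power2)
  have "Re u = 1"
    using 1 2 complex_Re_le_cmod[of u] assms by linarith
  with 2 show "u = 1" by (simp add: complex_eq_iff)
qed

lemma norm_prod_eq_1D:
  fixes f :: "'a \<Rightarrow> complex"
  assumes "finite A" "\<And>j. j \<in> A \<Longrightarrow> cmod (f j) \<le> 1" "cmod (\<Prod>j\<in>A. f j) = 1" "j \<in> A"
  shows "cmod (f j) = 1"
proof -
  have "cmod (\<Prod>k\<in>A. f k) = cmod (f j) * (\<Prod>k\<in>A-{j}. cmod (f k))"
    using assms by (simp add: prod.remove[of A j] norm_mult prod_norm)
  also have "\<dots> \<le> cmod (f j) * 1"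
    using assms by (intro mult_left_mono prod_le_1) auto
  finally show ?thesis using assms by (simp add: order_antisym)
qed

text \<open>
  For \<open>w\<close> in the torus and a permutation \<open>g\<close>, a product of functions \<open>(1 + u) / 2\<close> that attains
  modulus \<open>1\<close> on the closed polydisc only where the last coordinate of the basic map agrees with
  that at \<open>w\<close> and the powers \<open>z j ^ m\<close> are those of \<open>w\<close>, permuted by \<open>g\<close>.
  The first factor is needed because the powers determine the last coordinate only up to a
  \<open>p\<close>-th root of unity.
\<close>

definition peak :: "nat \<Rightarrow> nat \<Rightarrow> nat \<Rightarrow> (nat \<Rightarrow> complex) \<Rightarrow> (nat \<Rightarrow> nat) \<Rightarrow> (nat \<Rightarrow> complex) \<Rightarrow> complex" where
  "peak m p d w g z = (1 + cnj (theta m p d w d) * theta m p d z d) / 2 *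
     (\<Prod>j=1..d. (1 + cnj (w (g j) ^ m) * z j ^ m) / 2)"

lemma cnj_mult_eq_1D:
  assumes "cmod a = 1" "cnj a * b = 1"
  shows "b = a"
proof -
  have "a * cnj a = 1" using assms(1) by (simp add: complex_norm_square[symmetric])
  hence "b = (a * cnj a) * b" by simp
  also have "\<dots> = a * (cnj a * b)" by (simp only: mult.assoc)
  finally show ?thesis using assms(2) by simp
qed

lemma norm_theta_last:
  "z \<in> closed_polydisc d \<Longrightarrow> cmod (theta m p d z d) \<le> 1"
  "w \<in> torus d \<Longrightarrow> cmod (theta m p d w d) = 1"
  by (auto simp: theta_def closed_polydisc_def torus_def norm_power prod_norm[symmetric]
      intro!: power_le_one prod_le_1 prod_nonneg)

lemma
  assumes w: "w \<in> torus d" and g: "g \<in> perms {1..d}" and z: "z \<in> closed_polydisc d"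
  shows norm_peak_le_1: "cmod (peak m p d w g z) \<le> 1"
    and norm_peak_eq_1D: "cmod (peak m p d w g z) = 1 \<Longrightarrow> theta m p d z = theta m p d w"
    and norm_peak_eq_1D': "cmod (peak m p d w g z) = 1 \<Longrightarrow> peak m p d w g z = 1"
proof -
  define u where "u = cnj (theta m p d w d) * theta m p d z d"
  define v where "v = (\<lambda>j. cnj (w (g j) ^ m) * z j ^ m)"
  have u: "cmod u \<le> 1"
    using norm_theta_last[of _ d m p] w z by (simp add: u_def norm_mult)
  have wg: "cmod (w (g j) ^ m) = 1" if "j \<in> {1..d}" for j
    using w g that by (auto simp: torus_def perms_def PiE_iff norm_power)
  have v: "cmod (v j) \<le> 1" if "j \<in> {1..d}" for j
    using wg[OF that] z that
    by (auto simp: v_def closed_polydisc_def norm_mult norm_power intro!: power_le_one)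
  have eq: "peak m p d w g z = (1 + u) / 2 * (\<Prod>j=1..d. (1 + v j) / 2)"
    by (simp add: peak_def u_def v_def)
  have le: "cmod (\<Prod>j=1..d. (1 + v j) / 2) \<le> 1"
    unfolding prod_norm[symmetric] using half_one_plus(1)[OF v] by (intro prod_le_1) auto
  show "cmod (peak m p d w g z) \<le> 1"
    unfolding eq norm_mult using half_one_plus(1)[OF u] le by (intro mult_le_one) auto
  assume 1: "cmod (peak m p d w g z) = 1"
  hence "cmod ((1 + u) / 2) = 1" and prod1: "cmod (\<Prod>j=1..d. (1 + v j) / 2) = 1"
    using half_one_plus(1)[OF u] le mult_left_le[OF le, of "cmod ((1 + u) / 2)"]
      mult_left_le[OF half_one_plus(1)[OF u], of "cmod (\<Prod>j=1..d. (1 + v j) / 2)"]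
    unfolding eq norm_mult by (simp_all add: mult.commute)
  hence u1: "u = 1" using half_one_plus(2)[OF u] by blast
  have v1: "v j = 1" if "j \<in> {1..d}" for j
    using norm_prod_eq_1D[OF _ _ prod1 that] half_one_plus[OF v] that by blast
  show "peak m p d w g z = 1"
    unfolding eq using u1 v1 by simp
  have "theta m p d z d = theta m p d w d"
    using norm_theta_last(2)[OF w] u1 unfolding u_def by (rule cnj_mult_eq_1D)
  moreover have "esym d i (\<lambda>j. z j ^ m) = esym d i (\<lambda>j. w j ^ m)" for i
    using v1 wg unfolding v_def by (intro esym_perm[OF g]) (blast intro: cnj_mult_eq_1D)
  ultimately show "theta m p d z = theta m p d w"
    by (auto simp: theta_def fun_eq_iff)
qed

text \<open>
  A single function \<open>peak m p d w g\<close> need not be symmetric in the variables. The sum of the powers over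
  all \<open>g\<close> is a permanent times a function of the last coordinate of the basic map, and Ryser's formula
  turns the permanent into products over all variables of one polynomial.
\<close>

lemma descends_peak_sum:
  assumes "p dvd m" "d \<ge> 1"
  shows "descends m p d (\<lambda>z. \<Sum>g\<in>perms {1..d}. peak m p d w g z ^ N)"
proof -
  define c where "c = cnj (theta m p d w d)"
  define q where "q = (\<lambda>k. [:1/2, cnj (w k ^ m) / 2:] ^ N)"
  have q: "poly (q k) x = ((1 + cnj (w k ^ m) * x) / 2) ^ N" for k x
    by (simp add: q_def add_divide_distrib mult.commute)
  have "peak m p d w g z ^ N =
      ((1 + c * theta m p d z d) / 2) ^ N * (\<Prod>j=1..d. poly (q (g j)) (z j ^ m))" for g z
    unfolding peak_def c_def q by (simp only: power_mult_distrib prod_power_distrib)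
  hence "(\<Sum>g\<in>perms {1..d}. peak m p d w g z ^ N) = ((1 + c * theta m p d z d) / 2) ^ N *
      (\<Sum>S\<in>Pow {1..d}. (-1) ^ card ({1..d} - S) * (\<Prod>j=1..d. poly (\<Sum>k\<in>S. q k) (z j ^ m)))" for z
    using ryser_formula[of "{1..d}" "\<lambda>j k. poly (q k) (z j ^ m)"]
    by (simp add: poly_sum flip: sum_distrib_left)
  moreover have "descends m p d (\<lambda>z. ((1 + c * theta m p d z d) / 2) ^ N)"
  proof (rule descends_power)
    have "descends m p d (\<lambda>z. theta m p d z d)"
      using assms by (intro descends_theta) simp
    hence "descends m p d (\<lambda>z. (1 + c * theta m p d z d) * (1/2))"
      by (rule descends_mult[OF descends_add[OF descends_const descends_mult[OF descends_const]]
            descends_const])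
    thus "descends m p d (\<lambda>z. (1 + c * theta m p d z d) / 2)" by simp
  qed
  moreover have "descends m p d (\<lambda>z. \<Sum>S\<in>Pow {1..d}. (-1) ^ card ({1..d} - S) *
      (\<Prod>j=1..d. poly (\<Sum>k\<in>S. q k) (z j ^ m)))"
    by (rule descends_sum, rule descends_mult[OF descends_const descends_prod_poly[OF assms]])
  ultimately show ?thesis
    by (simp only: descends_mult)
qed

lemma continuous_on_peak: "continuous_on S (peak m p d w g)"
  unfolding peak_def
  by (intro continuous_intros continuous_on_coordinate
      continuous_on_product_then_coordinatewise[OF continuous_on_theta]) simp_all

text \<open>
  Suppose that \<open>K\<close> misses the image of \<open>w\<close>. Then every \<open>peak m p d w g\<close> is bounded by some \<open>\<rho> g < 1\<close> on
  the compact preimage of \<open>K\<close>, so on \<open>K\<close> the descended sum of \<open>N\<close>-th powers tends to \<open>0\<close> uniformly.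
  At \<open>w\<close> its terms tend to \<open>0\<close> or \<open>1\<close>, and the one for the identity is constantly \<open>1\<close>. For large
  \<open>N\<close> the maximum modulus is therefore not attained on \<open>K\<close>.
\<close>

lemma theta_torus_subset_closed_boundary:
  assumes "p dvd m" "d \<ge> 1" and K: "closed_boundary m p d K"
  shows "theta m p d ` torus d \<subseteq> K"
proof (rule ccontr)
  assume "\<not> ?thesis"
  then obtain w where w: "w \<in> torus d" "theta m p d w \<notin> K" by blast
  define G where "G = perms {1..d}"
  have finG: "finite G"
    unfolding G_def perms_def by (rule finite_subset[of _ "{1..d} \<rightarrow>\<^sub>E {1..d}"]) (auto intro: finite_PiE)
  define Z where "Z = closed_polydisc d \<inter> theta m p d -` K"
  have "compact Z"
  proof -
    have "closed (theta m p d -` K)"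
      using K continuous_on_theta by (auto simp: closed_boundary_def intro: closed_vimage)
    thus ?thesis unfolding Z_def using compact_closed_polydisc by (rule compact_Int_closed[rotated])
  qed
  have "\<exists>\<rho>. 0 \<le> \<rho> \<and> \<rho> < 1 \<and> (\<forall>z\<in>Z. cmod (peak m p d w g z) \<le> \<rho>)" if g: "g \<in> G" for g
  proof (cases "Z = {}")
    case False
    have "continuous_on Z (\<lambda>z. cmod (peak m p d w g z))"
      by (intro continuous_on_norm continuous_on_peak)
    from continuous_attains_sup[OF \<open>compact Z\<close> False this]
    obtain z where z: "z \<in> Z" "\<forall>y\<in>Z. cmod (peak m p d w g y) \<le> cmod (peak m p d w g z)" by blast
    have "cmod (peak m p d w g z) \<noteq> 1"
      using norm_peak_eq_1D[OF w(1), of g z] g z(1) w(2) by (auto simp: Z_def G_def)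
    hence "cmod (peak m p d w g z) < 1"
      using norm_peak_le_1[OF w(1), of g z] g z(1) by (simp add: Z_def G_def order_less_le)
    with z show ?thesis by (intro exI[of _ "cmod (peak m p d w g z)"]) auto
  qed (auto intro!: exI[of _ 0])
  then obtain \<rho> where \<rho>: "\<And>g. g \<in> G \<Longrightarrow> 0 \<le> \<rho> g" "\<And>g. g \<in> G \<Longrightarrow> \<rho> g < 1"
    "\<And>g z. g \<in> G \<Longrightarrow> z \<in> Z \<Longrightarrow> cmod (peak m p d w g z) \<le> \<rho> g"
    by metis
  have wP: "w \<in> closed_polydisc d" using w torus_subset by blast
  have "(\<lambda>N. \<Sum>g\<in>G. \<rho> g ^ N) \<longlonglongrightarrow> (\<Sum>g\<in>G. 0)"
    using \<rho> by (intro tendsto_sum LIMSEQ_power_zero) auto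
  hence small: "\<forall>\<^sub>F N in sequentially. (\<Sum>g\<in>G. \<rho> g ^ N) < 1/2"
    by (rule order_tendstoD) simp
  define L where "L = (\<lambda>g. if peak m p d w g w = 1 then 1 else 0 :: complex)"
  have "(\<lambda>N. \<Sum>g\<in>G. peak m p d w g w ^ N) \<longlonglongrightarrow> (\<Sum>g\<in>G. L g)"
  proof (rule tendsto_sum)
    fix g assume g: "g \<in> G"
    show "(\<lambda>N. peak m p d w g w ^ N) \<longlonglongrightarrow> L g"
    proof (cases "peak m p d w g w = 1")
      case False
      hence "cmod (peak m p d w g w) < 1"
        using norm_peak_le_1[OF w(1) _ wP, of g] norm_peak_eq_1D'[OF w(1) _ wP, of g] g
        by (force simp: G_def order_less_le)
      thus ?thesis using False by (simp add: L_def LIMSEQ_power_zero)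
    qed (simp add: L_def)
  qed
  hence lim: "(\<lambda>N. cmod (\<Sum>g\<in>G. peak m p d w g w ^ N)) \<longlonglongrightarrow> cmod (\<Sum>g\<in>G. L g)"
    by (rule tendsto_norm)
  define e where "e = restrict id {1..d}"
  have e: "e \<in> G" by (auto simp: e_def G_def perms_def)
  have "1 \<le> cmod (\<Sum>g\<in>G. L g)"
  proof -
    have unit: "cnj a * a = 1" if "cmod a = 1" for a
      using that by (simp add: complex_norm_square[symmetric] mult.commute)
    have "peak m p d w e w = 1"
      using w norm_theta_last(2)[OF w(1), of m p]
      by (auto simp: peak_def e_def unit torus_def norm_power simp flip: complex_cnj_power)
    hence "1 = Re (L e)" by (simp add: L_def)
    also have "\<dots> \<le> (\<Sum>g\<in>G. Re (L g))"
      using finG e by (intro member_le_sum) (auto simp: L_def)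
    also have "\<dots> \<le> cmod (\<Sum>g\<in>G. L g)"
      using complex_Re_le_cmod[of "\<Sum>g\<in>G. L g"] by simp
    finally show ?thesis .
  qed
  hence "\<forall>\<^sub>F N in sequentially. 1/2 < cmod (\<Sum>g\<in>G. peak m p d w g w ^ N)"
    using order_tendstoD(1)[OF lim, of "1/2"] by simp
  from eventually_happens[OF eventually_conj[OF small this]]
  obtain N where N: "(\<Sum>g\<in>G. \<rho> g ^ N) < 1/2" "1/2 < cmod (\<Sum>g\<in>G. peak m p d w g w ^ N)"
    by auto
  obtain f where f: "f \<in> Theta_algebra m p d"
    "\<And>z. z \<in> closed_polydisc d \<Longrightarrow> f (theta m p d z) = (\<Sum>g\<in>G. peak m p d w g z ^ N)"
    using descends_peak_sum[OF assms(1,2), of w N] unfolding descends_def G_def by blast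
  from K f(1) obtain x where x: "x \<in> K" "x \<in> closed_Theta_dom m p d"
    "\<And>y. y \<in> closed_Theta_dom m p d \<Longrightarrow> cmod (f y) \<le> cmod (f x)"
    unfolding closed_boundary_def by blast
  then obtain z where z: "z \<in> Z" "x = theta m p d z"
    unfolding closed_Theta_dom_def Z_def by blast
  have "1/2 < cmod (f (theta m p d w))"
    using N(2) f(2)[OF wP] by simp
  also have "\<dots> \<le> cmod (f x)"
    using wP by (intro x(3)) (auto simp: closed_Theta_dom_def)
  also have "\<dots> = cmod (\<Sum>g\<in>G. peak m p d w g z ^ N)"
    using f(2) z by (simp add: Z_def)
  also have "\<dots> \<le> (\<Sum>g\<in>G. \<rho> g ^ N)"
    using \<rho>(3) z by (intro sum_norm_le) (auto simp: norm_power intro: power_mono)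
  finally show False using N(1) by simp
qed

theorem distinguished_boundary_eq:
  assumes "p dvd m" "d \<ge> 1"
  shows "distinguished_boundary m p d = theta m p d ` torus d"
  unfolding distinguished_boundary_def
  using closed_boundary_theta_torus[OF assms(2)] theta_torus_subset_closed_boundary[OF assms]
  by (intro Least_equality) auto

section \<open>Adjoining a unimodular variable\<close>

text \<open>
  The second term comes from the index sets that contain \<open>Suc n\<close>.
\<close>

lemma esym_Suc:
  "esym (Suc n) (Suc i) x = esym n (Suc i) x + x (Suc n) * esym n i x"
proof -
  let ?F = "\<lambda>n i. {S. S \<subseteq> {1..n} \<and> card S = i}"
  have split: "?F (Suc n) (Suc i) = ?F n (Suc i) \<union> insert (Suc n) ` ?F n i"
  proof (intro equalityI subsetI)
    fix S assume S: "S \<in> ?F (Suc n) (Suc i)"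
    hence fin: "finite S" using finite_subset by blast
    show "S \<in> ?F n (Suc i) \<union> insert (Suc n) ` ?F n i"
    proof (cases "Suc n \<in> S")
      case True
      have "S - {Suc n} \<in> ?F n i" "S = insert (Suc n) (S - {Suc n})"
        using S True fin by (auto simp: le_Suc_eq subset_iff)
      thus ?thesis by blast
    next
      case False
      thus ?thesis using S by (auto simp: subset_iff le_Suc_eq)
    qed
  next
    fix S assume "S \<in> ?F n (Suc i) \<union> insert (Suc n) ` ?F n i"
    thus "S \<in> ?F (Suc n) (Suc i)"
    proof
      assume "S \<in> insert (Suc n) ` ?F n i"
      then obtain T where T: "T \<subseteq> {1..n}" "card T = i" "S = insert (Suc n) T" by blast
      moreover have "finite T" "Suc n \<notin> T" using T(1) finite_subset by auto
      ultimately show ?thesis by auto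
    qed auto
  qed
  have inj: "inj_on (insert (Suc n)) (?F n i)"
    by (intro inj_onI) (metis (no_types, lifting) Diff_insert_absorb atLeastAtMost_iff
        mem_Collect_eq not_less_eq_eq order_refl subsetD)
  have "esym (Suc n) (Suc i) x =
      esym n (Suc i) x + (\<Sum>S\<in>insert (Suc n) ` ?F n i. \<Prod>j\<in>S. x j)"
    unfolding esym_def split by (intro sum.union_disjoint) auto
  also have "(\<Sum>S\<in>insert (Suc n) ` ?F n i. \<Prod>j\<in>S. x j) = (\<Sum>S\<in>?F n i. x (Suc n) * (\<Prod>j\<in>S. x j))"
    unfolding sum.reindex[OF inj] o_def
  proof (intro sum.cong refl)
    fix S assume "S \<in> ?F n i"
    hence "finite S" "Suc n \<notin> S" using finite_subset by auto
    thus "(\<Prod>j\<in>insert (Suc n) S. x j) = x (Suc n) * (\<Prod>j\<in>S. x j)" by simp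
  qed
  finally show ?thesis by (simp add: esym_def sum_distrib_left)
qed

lemma esym_cong: "(\<And>j. j \<in> {1..d} \<Longrightarrow> x j = y j) \<Longrightarrow> esym d i x = esym d i y"
  unfolding esym_def by (intro sum.cong prod.cong refl) auto

definition adjoin :: "nat \<Rightarrow> nat \<Rightarrow> nat \<Rightarrow> complex \<Rightarrow> (nat \<Rightarrow> complex) \<Rightarrow> nat \<Rightarrow> complex" where
  "adjoin m p n \<alpha> x i =
     (if i = 1 then \<alpha> ^ m + x 1
      else if 2 \<le> i \<and> i \<le> n - 1 then \<alpha> ^ m * x (i - 1) + x i
      else if i = n then \<alpha> ^ m * x (n - 1) + x n ^ p
      else if i = n + 1 then \<alpha> ^ (m div p) * x n
      else 0)"

text \<open>
  This explains the formula in \<open>adjoin\<close>: it is the recursion for the elementary symmetric polynomials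
  when \<open>\<alpha> ^ m\<close> joins the variables \<open>z j ^ m\<close>. The power \<open>x n ^ p\<close> occurs because the top symmetric
  polynomial of the \<open>z j ^ m\<close> is the \<open>p\<close>-th power of the last coordinate.
\<close>

lemma adjoin_theta:
  assumes "p dvd m" "n \<ge> 2"
  shows "adjoin m p n \<alpha> (theta m p n z) = theta m p (n + 1) (z(n + 1 := \<alpha>))"
proof
  fix i
  define y where "y = z(n + 1 := \<alpha>)"
  have th: "theta m p n z k = esym n k (\<lambda>j. y j ^ m)" if "1 \<le> k" "k < n" for k
    using that by (auto simp: theta_def y_def intro!: esym_cong)
  have top: "theta m p n z n ^ p = esym n n (\<lambda>j. y j ^ m)"
    unfolding esym_top_eq_theta[OF assms(1), symmetric]
    by (auto simp: y_def intro!: esym_cong)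
  have y: "y (Suc n) = \<alpha>" by (simp add: y_def)
  have S: "theta m p (n + 1) y i = esym n i (\<lambda>j. y j ^ m) + \<alpha> ^ m * esym n (i - 1) (\<lambda>j. y j ^ m)"
    if "1 \<le> i" "i \<le> n"
    using that esym_Suc[of n "i - 1" "\<lambda>j. y j ^ m"] by (simp add: theta_def y)
  consider "i = 0" | "i = 1" | "2 \<le> i" "i \<le> n - 1" | "i = n" | "i = n + 1" | "i > n + 1"
    by linarith
  hence "adjoin m p n \<alpha> (theta m p n z) i = theta m p (n + 1) y i"
  proof cases
    case 1 then show ?thesis using assms by (simp add: adjoin_def theta_def)
  next
    case 2 then show ?thesis using assms S th[of 1] by (simp add: adjoin_def esym_0)
  next
    case 3 then show ?thesis using assms S th[of i] th[of "i - 1"] by (simp add: adjoin_def)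
  next
    case 4
    have "\<not> n \<le> n - 1" using assms by simp
    then show ?thesis using 4 assms S top th[of "n - 1"] by (simp add: adjoin_def)
  next
    case 5
    have "(\<Prod>j=1..n. y j) = (\<Prod>j=1..n. z j)"
      by (intro prod.cong) (auto simp: y_def)
    then show ?thesis using 5 assms
      by (simp add: adjoin_def theta_def y power_mult_distrib mult.commute)
  next
    case 6 then show ?thesis using assms by (simp add: adjoin_def theta_def)
  qed
  thus "adjoin m p n \<alpha> (theta m p n z) i = theta m p (n + 1) (z(n + 1 := \<alpha>)) i"
    by (simp add: y_def)
qed

lemma tendsto_adjoin:
  assumes "(f \<longlongrightarrow> L) F"
  shows "((\<lambda>r. adjoin m p n \<alpha> (f r)) \<longlongrightarrow> adjoin m p n \<alpha> L) F"
  unfolding tendsto_coordinatewise_iff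
proof
  fix i
  have *: "((\<lambda>r. f r k) \<longlongrightarrow> L k) F" for k
    using assms by (simp add: tendsto_coordinatewise_iff)
  show "((\<lambda>r. adjoin m p n \<alpha> (f r) i) \<longlongrightarrow> adjoin m p n \<alpha> L i) F"
    unfolding adjoin_def by (auto intro!: tendsto_intros *)
qed

lemma Theta_inner_adjoin:
  assumes "p dvd m" "n \<ge> 2" and inner: "Theta_inner m p n \<Theta>" and \<alpha>: "cmod \<alpha> = 1"
  shows "Theta_inner m p (n + 1) (\<lambda>z. adjoin m p n \<alpha> (\<Theta> z))"
proof -
  have hol: "(\<lambda>z. \<Theta> z i) holomorphic_on ball 0 1" if "1 \<le> i" "i \<le> n" for i
    using inner that by (simp add: Theta_inner_def)
  have torus: "y(n + 1 := \<alpha>) \<in> torus (n + 1)" if "y \<in> torus n" for y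
    using that \<alpha> by (auto simp: torus_def cspace_def)
  have polydisc: "y(n + 1 := \<alpha>) \<in> closed_polydisc (n + 1)" if "y \<in> closed_polydisc n" for y
    using that \<alpha> by (auto simp: closed_polydisc_def cspace_def)
  have bdry: "adjoin m p n \<alpha> L \<in> distinguished_boundary m p (n + 1)"
    if "L \<in> distinguished_boundary m p n" for L
    using that assms(1,2) torus by (auto simp: distinguished_boundary_eq adjoin_theta)
  show ?thesis
    unfolding Theta_inner_def
  proof (intro conjI ballI)
    fix i assume "i \<in> {1..n + 1}"
    show "(\<lambda>z. adjoin m p n \<alpha> (\<Theta> z) i) holomorphic_on ball 0 1"
      unfolding adjoin_def using assms(2)
      by (cases "i = 1"; cases "2 \<le> i \<and> i \<le> n - 1"; cases "i = n"; cases "i = n + 1")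
         (auto intro!: holomorphic_intros hol)
  next
    show "(\<lambda>z. adjoin m p n \<alpha> (\<Theta> z)) ` ball 0 1 \<subseteq> closed_Theta_dom m p (n + 1)"
    proof (rule image_subsetI)
      fix z :: complex assume "z \<in> ball 0 1"
      with inner obtain y where "y \<in> closed_polydisc n" "\<Theta> z = theta m p n y"
        unfolding Theta_inner_def closed_Theta_dom_def by blast
      thus "adjoin m p n \<alpha> (\<Theta> z) \<in> closed_Theta_dom m p (n + 1)"
        using polydisc assms(1,2) by (simp add: adjoin_theta closed_Theta_dom_def)
    qed
  next
    have "AE t in lebesgue_on {0..2*pi}. \<exists>L\<in>distinguished_boundary m p n.
        ((\<lambda>r. \<Theta> (of_real r * cis t)) \<longlongrightarrow> L) (at_left (1::real))"
      using inner by (simp add: Theta_inner_def)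
    thus "AE t in lebesgue_on {0..2*pi}. \<exists>L\<in>distinguished_boundary m p (n + 1).
        ((\<lambda>r. adjoin m p n \<alpha> (\<Theta> (of_real r * cis t))) \<longlongrightarrow> L) (at_left (1::real))"
      by eventually_elim (use bdry tendsto_adjoin in blast)
  qed
qed

theorem proposition4p6:
  fixes m p n :: nat
    and \<Theta> :: "complex \<Rightarrow> nat \<Rightarrow> complex"
  assumes "m > 0" and "p > 0" and "p dvd m" and "n \<ge> 2"
    and "Theta_inner m p n \<Theta>"
  shows "\<forall>\<alpha>\<in>sphere (0::complex) 1.
    Theta_inner m p (n + 1)
      (\<lambda>z i. if i = 1 then \<alpha> ^ m + \<Theta> z 1
             else if 2 \<le> i \<and> i \<le> n - 1 then \<alpha> ^ m * \<Theta> z (i - 1) + \<Theta> z i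
             else if i = n then \<alpha> ^ m * \<Theta> z (n - 1) + \<Theta> z n ^ p
             else if i = n + 1 then \<alpha> ^ (m div p) * \<Theta> z n
             else 0)"
  using Theta_inner_adjoin[OF assms(3-5)] by (simp add: adjoin_def[abs_def])

end
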